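(* For every $d\in\mathbb{N}$ and every $0<\beta<d$, there exist a probability density $\mu$ on $\mathbb{R}^d$ and a target function $f^*:\mathbb{R}^d\to\{\pm1\}$ satisfying the regularity assumption below, and absolute constants $C_1,C_2\in(0,1)$, such that with $c(\beta,d):=C_1^{\beta}\cdot(1-\beta/d)>0$, for every $p\in(0,0.49)$, \[ \mathcal{L}(\hat{h}_\beta)\geq C_2\cdot c(\beta,d). \]
   Context: Training data $S=(\mathbf{x}_i,y_i)_{i=1}^m\subset\mathbb{R}^d\times\{\pm1\}$: the $\mathbf{x}_i$ are i.i.d. from the distribution $\mathcal{D}_\mathbf{x}$ with density $\mu$, and independently for each $i$, $y_i=f^*(\mathbf{x}_i)$ with probability $1-p$ and $y_i=-f^*(\mathbf{x}_i)$ with probability $p$. The Nadaraya–Watson interpolator is $\hat{h}_\beta(\mathbf{x})=\mathrm{sign}\big(\sum_{i=1}^m y_i\|\mathbf{x}-\mathbf{x}_i\|^{-\beta}\big)$ if $\mathbf{x}\notin\{\mathbf{x}_1,\dots,\mathbf{x}_m\}$, and $\hat{h}_\beta(\mathbf{x}_i)=y_i$. The asymptotic clean classification error is $\mathcal{L}(\hat{h}_\beta)=\lim_{m\to\infty}\mathbb{E}_S\big[\Pr_{\mathbf{x}\sim\mathcal{D}_\mathbf{x}}[\hat{h}_\beta(\mathbf{x})\neq f^*(\mathbf{x})]\big]$; if the limit does not exist, the lower bound is to be read for the $\liminf$. Regularity assumption: $\mu$ is continuous at Lebesgue-almost every $\mathbf{x}\in\mathbb{R}^d$, and for Lebesgue-almost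 every $\mathbf{x}$ there is a neighborhood of $\mathbf{x}$ on which $f^*$ is constant. *)

theory Defs
  imports "HOL-Probability.Probability"
begin

text \<open>Points of R^d are represented as extensional functions nat => real supported
  on {..<d}; Lebesgue measure on R^d is the product of d copies of lborel.\<close>

definition lborel_d :: "nat \<Rightarrow> (nat \<Rightarrow> real) measure" where
  "lborel_d d = PiM {..<d} (\<lambda>_. lborel)"

definition euclid_dist :: "nat \<Rightarrow> (nat \<Rightarrow> real) \<Rightarrow> (nat \<Rightarrow> real) \<Rightarrow> real" where
  "euclid_dist d x y = sqrt (\<Sum>i<d. (x i - y i)^2)"

definition is_prob_density :: "nat \<Rightarrow> ((nat \<Rightarrow> real) \<Rightarrow> real) \<Rightarrow> bool" where
  "is_prob_density d \<mu> \<longleftrightarrow> \<mu> \<in> borel_measurable (lborel_d d)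
     \<and> (\<forall>x\<in>space (lborel_d d). 0 \<le> \<mu> x)
     \<and> (\<integral>\<^sup>+ x. ennreal (\<mu> x) \<partial>lborel_d d) = 1"

definition D_x :: "nat \<Rightarrow> ((nat \<Rightarrow> real) \<Rightarrow> real) \<Rightarrow> (nat \<Rightarrow> real) measure" where
  "D_x d \<mu> = density (lborel_d d) (\<lambda>x. ennreal (\<mu> x))"

text \<open>target function with values in {-1,1} (required Borel measurable so that the error is an event)\<close>
definition is_target :: "nat \<Rightarrow> ((nat \<Rightarrow> real) \<Rightarrow> real) \<Rightarrow> bool" where
  "is_target d f \<longleftrightarrow> f \<in> borel_measurable (lborel_d d)
     \<and> (\<forall>x\<in>space (lborel_d d). f x = 1 \<or> f x = -1)"

definition regularity :: "nat \<Rightarrow> ((nat \<Rightarrow> real) \<Rightarrow> real) \<Rightarrow> ((nat \<Rightarrow> real) \<Rightarrow> real) \<Rightarrow> bool" where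
  "regularity d \<mu> f \<longleftrightarrow>
     (AE x in lborel_d d. \<forall>\<epsilon>>0. \<exists>\<delta>>0. \<forall>y\<in>space (lborel_d d).
         euclid_dist d x y < \<delta> \<longrightarrow> \<bar>\<mu> y - \<mu> x\<bar> < \<epsilon>)
   \<and> (AE x in lborel_d d. \<exists>\<delta>>0. \<forall>y\<in>space (lborel_d d).
         euclid_dist d x y < \<delta> \<longrightarrow> f y = f x)"

text \<open>Nadaraya-Watson interpolator built from sample points xs 0..m-1 with labels ys\<close>
definition nw_pred :: "nat \<Rightarrow> real \<Rightarrow> nat \<Rightarrow> (nat \<Rightarrow> (nat \<Rightarrow> real)) \<Rightarrow> (nat \<Rightarrow> real)
     \<Rightarrow> (nat \<Rightarrow> real) \<Rightarrow> real" where
  "nw_pred d \<beta> m xs ys x =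
     (if \<exists>i<m. x = xs i then ys (LEAST i. i < m \<and> x = xs i)
      else sgn (\<Sum>i<m. ys i * euclid_dist d x (xs i) powr (-\<beta>)))"

text \<open>A sample is s i = (x_i, flip_i); flip_i ~ Bernoulli(p) independently of x_i ~ D_x.\<close>
definition sample_measure :: "nat \<Rightarrow> ((nat \<Rightarrow> real) \<Rightarrow> real) \<Rightarrow> real \<Rightarrow> nat
     \<Rightarrow> (nat \<Rightarrow> (nat \<Rightarrow> real) \<times> bool) measure" where
  "sample_measure d \<mu> p m = PiM {..<m} (\<lambda>_. D_x d \<mu> \<Otimes>\<^sub>M measure_pmf (bernoulli_pmf p))"

definition noisy_label :: "((nat \<Rightarrow> real) \<Rightarrow> real) \<Rightarrow> (nat \<Rightarrow> (nat \<Rightarrow> real) \<times> bool) \<Rightarrow> nat \<Rightarrow> real" where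
  "noisy_label f s i = (if snd (s i) then - f (fst (s i)) else f (fst (s i)))"

definition clean_error :: "nat \<Rightarrow> ((nat \<Rightarrow> real) \<Rightarrow> real) \<Rightarrow> ((nat \<Rightarrow> real) \<Rightarrow> real)
     \<Rightarrow> real \<Rightarrow> real \<Rightarrow> nat \<Rightarrow> real" where
  "clean_error d \<mu> f \<beta> p m =
     (\<integral>s. measure (D_x d \<mu>)
            {x \<in> space (D_x d \<mu>). nw_pred d \<beta> m (\<lambda>i. fst (s i)) (noisy_label f s) x \<noteq> f x}
        \<partial>sample_measure d \<mu> p m)"

end

theory Submission
  imports Defs "HOL-Real_Asymp.Real_Asymp"
begin

text \<open>Put mass \<open>\<alpha> = 8\<^sup>-\<^sup>\<beta> (1 - \<beta>/d) / 1000\<close> uniformly on the unit ball, where the target is \<open>-1\<close>,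
  and the remaining mass uniformly on the spherical shell of radii 2 and 3, where it is \<open>1\<close>.
  At a point of the unit ball each shell point votes with weight at least \<open>4\<^sup>-\<^sup>\<beta>\<close>, and at most 1, so
  by Hoeffding's inequality the total shell vote is about \<open>(1 - 2p) 4\<^sup>-\<^sup>\<beta>\<close> per sample or more. Since
  \<open>\<beta> < d\<close> the kernel is integrable at 0, and the mean vote of the ball has absolute value at most
  \<open>3 \<alpha> 2\<^sup>\<beta> / (1 - \<beta>/d)\<close>, which is smaller; Markov's inequality makes the shell win with probability
  at least 1/2 for large samples, however heavy-tailed the ball votes are. So the error is
  asymptotically at least \<open>\<alpha>/2\<close>.\<close>

subsection \<open>Balls in product Lebesgue measure\<close>

lemma measurable_component_lborel_d [measurable (raw)]:
  assumes "i < d" "f \<in> measurable M (lborel_d d)"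
  shows "(\<lambda>x. f x i) \<in> borel_measurable M"
proof -
  have "(\<lambda>x. x i) \<in> measurable (lborel_d d) borel"
    unfolding lborel_d_def using assms(1) by simp
  from measurable_compose[OF assms(2) this] show ?thesis .
qed

lemma measurable_euclid_dist [measurable (raw)]:
  assumes [measurable]: "f \<in> measurable M (lborel_d d)" "g \<in> measurable M (lborel_d d)"
  shows "(\<lambda>x. euclid_dist d (f x) (g x)) \<in> borel_measurable M"
  unfolding euclid_dist_def by measurable

lemma euclid_dist_eq_L2_set: "euclid_dist d x y = L2_set (\<lambda>i. x i - y i) {..<d}"
  by (simp add: euclid_dist_def L2_set_def)

lemma euclid_dist_nonneg: "0 \<le> euclid_dist d x y"
  by (simp add: euclid_dist_eq_L2_set)

lemma euclid_dist_commute: "euclid_dist d x y = euclid_dist d y x"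
  by (simp add: euclid_dist_def power2_commute)

lemma euclid_dist_triangle: "euclid_dist d x z \<le> euclid_dist d x y + euclid_dist d y z"
  using L2_set_triangle_ineq[of "\<lambda>i. x i - y i" "\<lambda>i. y i - z i" "{..<d}"]
  by (simp add: euclid_dist_eq_L2_set)

text \<open>Distance zero only forces agreement on the first \<open>d\<close> coordinates; members
  of the space are extensional and therefore agree elsewhere too.\<close>

lemma euclid_dist_eq_0_iff:
  assumes "x \<in> space (lborel_d d)" "y \<in> space (lborel_d d)"
  shows "euclid_dist d x y = 0 \<longleftrightarrow> x = y"
proof
  assume "euclid_dist d x y = 0"
  then have "\<forall>i<d. x i = y i"
    by (auto simp: euclid_dist_def sum_nonneg_eq_0_iff)
  with assms show "x = y"
    by (intro PiE_ext[of x "{..<d}" "\<lambda>_. UNIV" y]) (auto simp: lborel_d_def space_PiM)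
qed (simp add: euclid_dist_def)

text \<open>A product measure is determined by its values on boxes. The preimage of a box under a
  translation is a box with translated sides, and \<open>lborel\<close> is translation invariant on
  each side. This is used to move balls to the origin.\<close>

lemma distr_lborel_d_plus:
  "distr (lborel_d d) (lborel_d d) (\<lambda>z. \<lambda>i\<in>{..<d}. x i + z i) = lborel_d d"
proof -
  interpret product_sigma_finite "\<lambda>_::nat. lborel :: real measure"
    by standard
  have meas: "(\<lambda>z. \<lambda>i\<in>{..<d}. x i + z i) \<in> measurable (lborel_d d) (lborel_d d)"
    unfolding lborel_d_def by measurable
  show ?thesis
    unfolding lborel_d_def
  proof (rule PiM_eqI)
    fix A :: "nat \<Rightarrow> real set" assume A: "\<And>i. i \<in> {..<d} \<Longrightarrow> A i \<in> sets lborel"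
    let ?B = "\<lambda>i. (\<lambda>t. x i + t) -` A i"
    have B: "?B i \<in> sets lborel" if "i \<in> {..<d}" for i
    proof -
      have "(\<lambda>t. x i + t) -` A i \<inter> space borel \<in> sets borel"
        by (rule measurable_sets[of _ borel borel]) (use A[OF that] in auto)
      then show ?thesis by simp
    qed
    have eq: "emeasure lborel (?B i) = emeasure lborel (A i)" if "i < d" for i
    proof -
      have "emeasure lborel (A i) = emeasure (distr lborel borel ((+) (x i))) (A i)"
        by (simp add: lborel_distr_plus)
      also have "\<dots> = emeasure lborel (?B i)"
        using A[of i] that by (subst emeasure_distr) auto
      finally show ?thesis by simp
    qed
    have "emeasure (distr (lborel_d d) (lborel_d d) (\<lambda>z. \<lambda>i\<in>{..<d}. x i + z i)) (Pi\<^sub>E {..<d} A)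
        = emeasure (lborel_d d) ((\<lambda>z. \<lambda>i\<in>{..<d}. x i + z i) -` Pi\<^sub>E {..<d} A \<inter> space (lborel_d d))"
    proof (rule emeasure_distr[OF meas])
      show "Pi\<^sub>E {..<d} A \<in> sets (lborel_d d)"
        unfolding lborel_d_def by (rule sets_PiM_I_finite) (use A in auto)
    qed
    also have "(\<lambda>z. \<lambda>i\<in>{..<d}. x i + z i) -` Pi\<^sub>E {..<d} A \<inter> space (lborel_d d) = Pi\<^sub>E {..<d} ?B"
      by (auto simp: lborel_d_def space_PiM PiE_iff)
    also have "emeasure (lborel_d d) (Pi\<^sub>E {..<d} ?B) = (\<Prod>i<d. emeasure lborel (?B i))"
      unfolding lborel_d_def by (rule emeasure_PiM) (use B in auto)
    also have "\<dots> = (\<Prod>i<d. emeasure lborel (A i))"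
      by (intro prod.cong) (auto simp: eq)
    finally show "emeasure (distr (Pi\<^sub>M {..<d} (\<lambda>_. lborel)) (Pi\<^sub>M {..<d} (\<lambda>_. lborel))
       (\<lambda>z. \<lambda>i\<in>{..<d}. x i + z i)) (Pi\<^sub>E {..<d} A) = (\<Prod>i\<in>{..<d}. emeasure lborel (A i))"
      unfolding lborel_d_def .
  qed auto
qed

text \<open>Only the coordinates of the centre below \<open>d\<close> enter the distance, so the
  centre need not be extensional and the origin can be written \<open>\<lambda>_. 0\<close>.\<close>

definition dball :: "nat \<Rightarrow> (nat \<Rightarrow> real) \<Rightarrow> real \<Rightarrow> (nat \<Rightarrow> real) set" where
  "dball d x r = {z \<in> space (lborel_d d). euclid_dist d x z \<le> r}"

lemma sets_dball [measurable]: "dball d x r \<in> sets (lborel_d d)"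
proof -
  have "(\<lambda>z. euclid_dist d x z) \<in> borel_measurable (lborel_d d)"
    unfolding euclid_dist_def by measurable
  then show ?thesis unfolding dball_def by measurable
qed

lemma dball_mono: "r \<le> s \<Longrightarrow> dball d x r \<subseteq> dball d x s"
  by (auto simp: dball_def)

lemma emeasure_dball:
  assumes "r > 0"
  shows "emeasure (lborel_d d) (dball d x r) = ennreal (unit_ball_vol (real d) * r ^ d)"
proof -
  have meas: "(\<lambda>z. \<lambda>i\<in>{..<d}. x i + z i) \<in> measurable (lborel_d d) (lborel_d d)"
    unfolding lborel_d_def by measurable
  have "emeasure (lborel_d d) (dball d x r)
      = emeasure (distr (lborel_d d) (lborel_d d) (\<lambda>z. \<lambda>i\<in>{..<d}. x i + z i)) (dball d x r)"
    by (simp add: distr_lborel_d_plus)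
  also have "\<dots> = emeasure (lborel_d d)
      ((\<lambda>z. \<lambda>i\<in>{..<d}. x i + z i) -` dball d x r \<inter> space (lborel_d d))"
    by (rule emeasure_distr[OF meas sets_dball])
  also have "(\<lambda>z. \<lambda>i\<in>{..<d}. x i + z i) -` dball d x r \<inter> space (lborel_d d)
      = {f. sqrt (\<Sum>i<d. (f i)\<^sup>2) \<le> r} \<inter> space (lborel_d d)"
    by (auto simp: dball_def euclid_dist_def lborel_d_def space_PiM)
  also have "emeasure (lborel_d d) \<dots> = ennreal (unit_ball_vol (real d) * r ^ d)"
    unfolding lborel_d_def using emeasure_cball_aux[of "{..<d}" r] assms by simp
  finally show ?thesis .
qed

text \<open>For every \<open>s\<close> in (0, r) the sphere lies in the difference of the balls of
  radii \<open>r\<close> and \<open>s\<close>, whose volume V (r^d - s^d) tends to 0 as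
  \<open>s\<close> increases to \<open>r\<close>.\<close>

lemma null_sets_sphere:
  assumes "r > 0" "d > 0"
  shows "{z \<in> space (lborel_d d). euclid_dist d x z = r} \<in> null_sets (lborel_d d)"
proof (rule null_setsI)
  let ?S = "{z \<in> space (lborel_d d). euclid_dist d x z = r}"
  let ?V = "unit_ball_vol (real d)"
  have "(\<lambda>z. euclid_dist d x z) \<in> borel_measurable (lborel_d d)"
    unfolding euclid_dist_def by measurable
  then show S: "?S \<in> sets (lborel_d d)" by measurable
  have le: "emeasure (lborel_d d) ?S \<le> ennreal (?V * r ^ d - ?V * s ^ d)" if "0 < s" "s < r" for s
  proof -
    have "emeasure (lborel_d d) ?S \<le> emeasure (lborel_d d) (dball d x r - dball d x s)"
      by (intro emeasure_mono sets.Diff sets_dball) (use that in \<open>auto simp: dball_def\<close>)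
    also have "\<dots> = emeasure (lborel_d d) (dball d x r) - emeasure (lborel_d d) (dball d x s)"
      using that by (intro emeasure_Diff sets_dball dball_mono) (auto simp: emeasure_dball)
    also have "\<dots> = ennreal (?V * r ^ d - ?V * s ^ d)"
      using that assms by (simp add: emeasure_dball ennreal_minus)
    finally show ?thesis .
  qed
  have "((\<lambda>s. ennreal (?V * r ^ d - ?V * s ^ d)) \<longlongrightarrow> ennreal (?V * r ^ d - ?V * r ^ d)) (at_left r)"
    by (intro tendsto_intros)
  moreover have "eventually (\<lambda>s. emeasure (lborel_d d) ?S \<le> ennreal (?V * r ^ d - ?V * s ^ d)) (at_left r)"
    using eventually_at_left_real[OF assms(1)] by eventually_elim (use le in auto)
  ultimately have "emeasure (lborel_d d) ?S \<le> ennreal (?V * r ^ d - ?V * r ^ d)"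
    by (intro tendsto_lowerbound) auto
  then show "emeasure (lborel_d d) ?S = 0" by simp
qed

section \<open>Integrability of the kernel at its pole\<close>

lemma dyadic_scale:
  fixes t :: real assumes "0 < t" "t \<le> 1"
  obtains k :: nat where "(1/2) ^ Suc k < t" "t \<le> (1/2) ^ k"
proof -
  obtain n :: nat where n: "(1/2) ^ n < t"
    using real_arch_pow_inv[of t "1/2"] assms by auto
  define j where "j = (LEAST n. (1/2::real) ^ n < t)"
  have j: "(1/2) ^ j < t" unfolding j_def by (rule LeastI[of _ n]) fact
  \<comment> \<open>Since \<open>t \<le> 1\<close>, the least exponent is not 0 and has a
    predecessor; minimality of \<open>j\<close> at that predecessor is the upper bound on
    \<open>t\<close>.\<close>
  have "j \<noteq> 0" using j assms by (intro notI) simp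
  then obtain k where k: "j = Suc k" by (cases j) auto
  have "\<not> (1/2) ^ k < t" using not_less_Least[of k "\<lambda>n. (1/2::real) ^ n < t"] k j_def by simp
  with j k that show ?thesis by auto
qed

text \<open>At distances in (2^-(k+1), 2^-k] the kernel is at most 2^((k+1) \<beta>), and the ball
  of radius 2^-k has volume V 2^(-k d). Summing over the dyadic scales gives a geometric series of
  ratio \<open>q\<close> = 2^(\<beta> - d), which converges because \<beta> < d.\<close>

lemma nn_integral_kernel_dball:
  assumes "0 < \<beta>" "\<beta> < real d"
  shows "(\<integral>\<^sup>+z. ennreal (euclid_dist d x z powr (-\<beta>)) * indicator (dball d x 1) z \<partial>lborel_d d)
    \<le> ennreal (unit_ball_vol (real d) * (2 powr \<beta> / (1 - 2 powr (\<beta> - real d))))"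
proof -
  let ?V = "unit_ball_vol (real d)"
  define q where "q = (2::real) powr (\<beta> - real d)"
  have q: "0 < q" "q < 1" using assms by (auto simp: q_def intro!: powr_less_one)
  have "(\<integral>\<^sup>+z. ennreal (euclid_dist d x z powr (-\<beta>)) * indicator (dball d x 1) z \<partial>lborel_d d)
      \<le> (\<integral>\<^sup>+z. (\<Sum>k. ennreal (2 powr ((real k + 1) * \<beta>)) * indicator (dball d x ((1/2) ^ k)) z) \<partial>lborel_d d)"
  proof (rule nn_integral_mono)
    fix z assume z: "z \<in> space (lborel_d d)"
    let ?t = "euclid_dist d x z"
    show "ennreal (?t powr (-\<beta>)) * indicator (dball d x 1) z
      \<le> (\<Sum>k. ennreal (2 powr ((real k + 1) * \<beta>)) * indicator (dball d x ((1/2) ^ k)) z)"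
    proof (cases "0 < ?t \<and> ?t \<le> 1")
      case True
      then obtain k where k: "(1/2) ^ Suc k < ?t" "?t \<le> (1/2) ^ k" using dyadic_scale by blast
      have "?t powr (-\<beta>) \<le> ((1/2) ^ Suc k) powr (-\<beta>)"
        using k assms by (intro powr_mono2') auto
      also have "\<dots> = 2 powr ((real k + 1) * \<beta>)"
        by (simp add: powr_realpow[symmetric] powr_powr powr_divide powr_minus_divide
              flip: power_Suc) (simp add: powr_realpow[symmetric] powr_powr add.commute)
      finally have "ennreal (?t powr (-\<beta>)) * indicator (dball d x 1) z
         \<le> ennreal (2 powr ((real k + 1) * \<beta>)) * indicator (dball d x ((1/2) ^ k)) z"
        using k z by (auto simp: dball_def indicator_def)
      also have "\<dots> \<le> (\<Sum>k. ennreal (2 powr ((real k + 1) * \<beta>)) * indicator (dball d x ((1/2) ^ k)) z)"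
      proof -
        define F where "F k = ennreal (2 powr ((real k + 1) * \<beta>)) * indicator (dball d x ((1/2) ^ k)) z" for k :: nat
        have "F k \<le> suminf F" using sum_le_suminf[of F "{k}"] by (simp add: summableI)
        then show ?thesis by (simp add: F_def[abs_def])
      qed
      finally show ?thesis .
    next
      case False
      then have "?t = 0 \<or> ?t > 1" using euclid_dist_nonneg[of d x z] by linarith
      \<comment> \<open>At the pole itself the integrand is 0, because \<open>0 powr a = 0\<close>
        by convention.\<close>
      then have "ennreal (?t powr (-\<beta>)) * indicator (dball d x 1) z = 0"
        by (auto simp: dball_def indicator_def)
      then show ?thesis by (simp only: zero_le)
    qed
  qed
  also have "\<dots> = (\<Sum>k. \<integral>\<^sup>+z. ennreal (2 powr ((real k + 1) * \<beta>)) * indicator (dball d x ((1/2) ^ k)) z \<partial>lborel_d d)"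
    by (rule nn_integral_suminf) measurable
  also have "\<dots> = (\<Sum>k. ennreal (?V * 2 powr \<beta> * q ^ k))"
  proof (rule suminf_cong)
    fix k :: nat
    have "(\<integral>\<^sup>+z. ennreal (2 powr ((real k + 1) * \<beta>)) * indicator (dball d x ((1/2) ^ k)) z \<partial>lborel_d d)
       = ennreal (2 powr ((real k + 1) * \<beta>)) * ennreal (?V * ((1/2) ^ k) ^ d)"
      by (simp add: nn_integral_cmult_indicator emeasure_dball)
    also have "\<dots> = ennreal (?V * (2 powr ((real k + 1) * \<beta>) * ((1/2) ^ k) ^ d))"
      by (simp add: ennreal_mult' [symmetric] mult_ac)
    also have "((1/2::real) ^ k) ^ d = 2 powr (- (real k * real d))"
      by (simp add: powr_minus_divide power_divide powr_realpow[symmetric] powr_powr flip: power_mult)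
    also have "2 powr ((real k + 1) * \<beta>) * 2 powr (- (real k * real d)) = 2 powr \<beta> * q ^ k"
      using q unfolding q_def
      by (simp add: powr_realpow[symmetric] powr_powr powr_add[symmetric] algebra_simps)
    finally show "(\<integral>\<^sup>+z. ennreal (2 powr ((real k + 1) * \<beta>)) * indicator (dball d x ((1/2) ^ k)) z \<partial>lborel_d d)
       = ennreal (?V * 2 powr \<beta> * q ^ k)" by (simp add: mult_ac)
  qed
  also have "\<dots> = ennreal (?V * 2 powr \<beta> * (1 / (1 - q)))"
    using q by (intro suminf_ennreal_eq sums_mult geometric_sums) auto
  finally show ?thesis by (simp add: q_def)
qed

text \<open>For \<open>s \<le> 1\<close> convexity puts 2^-s below its chord over [0, 1], so the
  right-hand side is at least s/2; for larger \<open>s\<close> it is at least 1/2. Taking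
  \<open>s\<close> = d - \<beta> and \<open>D\<close> = d turns the denominator of the geometric
  series into a multiple of 1 - \<beta>/d.\<close>

lemma one_minus_two_powr_ge:
  fixes s :: real assumes "0 < s" "s \<le> D" "1 \<le> D"
  shows "s / (2 * D) \<le> 1 - 2 powr (-s)"
proof (cases "s \<le> 1")
  case True
  have "convex_on UNIV (\<lambda>t::real. exp (- ln 2 * t))"
    by (rule convex_on_realI[where f' = "\<lambda>t. - ln 2 * exp (- ln 2 * t)"])
      (auto intro!: derivative_eq_intros)
  from convex_onD[OF this, of s 0 1] assms True
  have "exp (- ln 2 * s) \<le> (1 - s) + s * exp (- ln 2)" by simp
  then have "2 powr (-s) \<le> 1 - s / 2" by (simp add: powr_def exp_minus mult.commute)
  moreover have "s / (2 * D) \<le> s / 2" using assms by (simp add: field_simps)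
  ultimately show ?thesis by linarith
next
  case False
  then have "2 powr (-s) \<le> 2 powr (-1::real)" by (intro powr_mono) auto
  then have "2 powr (-s) \<le> 1/2" by (simp add: powr_minus_divide)
  moreover have "s / (2 * D) \<le> 1/2" using assms by (simp add: field_simps)
  ultimately show ?thesis by linarith
qed

text \<open>Pole and ball centre may differ: within distance 1 of the pole the previous bound
  applies, and farther away the kernel is at most 1, which costs at most the volume of the
  ball.\<close>

lemma nn_integral_kernel_unit_ball:
  assumes "0 < \<beta>" "\<beta> < real d"
  shows "(\<integral>\<^sup>+z. ennreal (euclid_dist d x z powr (-\<beta>)) * indicator (dball d c 1) z \<partial>lborel_d d)
    \<le> ennreal (unit_ball_vol (real d) * (3 * 2 powr \<beta> / (1 - \<beta> / real d)))"
proof -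
  let ?V = "unit_ball_vol (real d)"
  have d: "real d > 0" using assms by linarith
  have "(\<integral>\<^sup>+z. ennreal (euclid_dist d x z powr (-\<beta>)) * indicator (dball d c 1) z \<partial>lborel_d d)
     \<le> (\<integral>\<^sup>+z. ennreal (euclid_dist d x z powr (-\<beta>)) * indicator (dball d x 1) z
          + indicator (dball d c 1) z \<partial>lborel_d d)"
  proof (rule nn_integral_mono)
    fix z assume z: "z \<in> space (lborel_d d)"
    have "ennreal (euclid_dist d x z powr (-\<beta>)) \<le> 1" if "euclid_dist d x z > 1"
      using powr_mono2'[of "-\<beta>" 1 "euclid_dist d x z"] that assms by simp
    with z show "ennreal (euclid_dist d x z powr (-\<beta>)) * indicator (dball d c 1) z
      \<le> ennreal (euclid_dist d x z powr (-\<beta>)) * indicator (dball d x 1) z + indicator (dball d c 1) z"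
      by (cases "euclid_dist d x z \<le> 1") (auto simp: dball_def indicator_def)
  qed
  also have "\<dots> = (\<integral>\<^sup>+z. ennreal (euclid_dist d x z powr (-\<beta>)) * indicator (dball d x 1) z \<partial>lborel_d d)
      + ennreal ?V"
  proof (subst nn_integral_add)
    have "(\<lambda>z. euclid_dist d x z) \<in> borel_measurable (lborel_d d)"
      unfolding euclid_dist_def by measurable
    then show "(\<lambda>z. ennreal (euclid_dist d x z powr (-\<beta>)) * indicator (dball d x 1) z)
       \<in> borel_measurable (lborel_d d)" by measurable
  qed (auto simp: emeasure_dball)
  also have "\<dots> \<le> ennreal (?V * (2 powr \<beta> / (1 - 2 powr (\<beta> - real d)))) + ennreal ?V"
    by (intro add_right_mono nn_integral_kernel_dball assms)
  also have "\<dots> = ennreal (?V * (2 powr \<beta> / (1 - 2 powr (\<beta> - real d)) + 1))"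
    using assms powr_less_one[of 2 "\<beta> - real d"] by (subst ennreal_plus[symmetric])
      (auto simp: algebra_simps intro!: divide_nonneg_nonneg mult_nonneg_nonneg)
  \<comment> \<open>The constant 3 is 2 + 1: the factor 2 comes from the bound on the denominator,
    and the extra 1 is absorbed because 2^\<beta> / (1 - \<beta>/d) is itself at least 1.\<close>
  also have "\<dots> \<le> ennreal (?V * (3 * 2 powr \<beta> / (1 - \<beta> / real d)))"
  proof (intro ennreal_leI mult_left_mono)
    have c: "0 < 1 - \<beta> / real d" "1 - \<beta> / real d \<le> 1" using assms d by (auto simp: field_simps)
    have "(1 - \<beta> / real d) / 2 \<le> 1 - 2 powr (\<beta> - real d)"
      using one_minus_two_powr_ge[of "real d - \<beta>" "real d"] assms d by (simp add: field_simps)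
    then have "2 powr \<beta> / (1 - 2 powr (\<beta> - real d)) \<le> 2 powr \<beta> / ((1 - \<beta> / real d) / 2)"
      using c by (intro divide_left_mono mult_pos_pos) auto
    moreover have "1 \<le> 2 powr \<beta> / (1 - \<beta> / real d)"
      using order_trans[OF c(2) ge_one_powr_ge_zero[of 2 \<beta>]] c(1) assms(1)
      by (simp only: le_divide_eq) simp
    ultimately show "2 powr \<beta> / (1 - 2 powr (\<beta> - real d)) + 1 \<le> 3 * 2 powr \<beta> / (1 - \<beta> / real d)"
      by (simp add: field_simps)
  qed simp
  finally show ?thesis .
qed

subsection \<open>Concentration of the votes\<close>

text \<open>Restriction to \<open>I\<close> is the identity on the product space, so the joint law
  of the coordinates is the product measure itself, which is also the product of their marginal
  laws.\<close>

lemma indep_vars_PiM_coordinates: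
  assumes "prob_space N" "I \<noteq> {}"
  shows "prob_space.indep_vars (PiM I (\<lambda>_. N)) (\<lambda>_. N) (\<lambda>i s. s i) I"
proof -
  interpret P: prob_space "PiM I (\<lambda>_. N)"
    by (rule prob_space_PiM) (rule assms)
  have "distr (PiM I (\<lambda>_. N)) (PiM I (\<lambda>_. N)) (\<lambda>s. \<lambda>i\<in>I. s i) = distr (PiM I (\<lambda>_. N)) (PiM I (\<lambda>_. N)) (\<lambda>s. s)"
    by (intro distr_cong) (auto simp: space_PiM PiE_iff extensional_def fun_eq_iff)
  also have "\<dots> = PiM I (\<lambda>_. N)" by (rule distr_id)
  also have "\<dots> = PiM I (\<lambda>i. distr (PiM I (\<lambda>_. N)) N (\<lambda>s. s i))"
    using assms by (intro PiM_cong refl distr_PiM_component[symmetric]) auto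
  finally show ?thesis
    using assms by (subst P.indep_vars_iff_distr_eq_PiM') auto
qed

text \<open>Only the bounded part \<open>g\<close> concentrates; the part \<open>h\<close> may have infinite variance,
  so it is only controlled through its mean.\<close>
lemma prob_sum_dominates:
  fixes g h :: "'a \<Rightarrow> real"
  assumes N: "prob_space N"
    and [measurable]: "g \<in> borel_measurable N" "h \<in> borel_measurable N"
    and g: "\<And>z. z \<in> space N \<Longrightarrow> \<bar>g z\<bar> \<le> 1" and h: "\<And>z. z \<in> space N \<Longrightarrow> 0 \<le> h z"
    and a: "a \<le> (\<integral>z. g z \<partial>N)" and b: "(\<integral>\<^sup>+z. ennreal (h z) \<partial>N) \<le> ennreal b" "0 \<le> b"
    and \<tau>: "0 < \<tau>" "\<tau> < a" and m: "0 < m"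
  defines "P \<equiv> PiM {..<m::nat} (\<lambda>_. N)"
  shows "1 - b / \<tau> - exp (- (real m * (a - \<tau>)\<^sup>2 / 2))
    \<le> measure P {s \<in> space P. (\<Sum>i<m. h (s i)) \<le> (\<Sum>i<m. g (s i))}"
proof -
  interpret N: prob_space N by fact
  interpret P: prob_space P unfolding P_def by (rule prob_space_PiM) (rule N)
  have coord [measurable]: "(\<lambda>s. s i) \<in> measurable P N" if "i < m" for i
    unfolding P_def using that by simp
  have distr_coord: "distr P N (\<lambda>s. s i) = N" if "i < m" for i
    unfolding P_def using that N by (intro distr_PiM_component) auto
  have ind: "P.indep_vars (\<lambda>_. borel) (\<lambda>i s. g (s i)) {..<m}"
    unfolding P_def
    by (rule prob_space.indep_vars_compose2[OF _ indep_vars_PiM_coordinates[OF N]])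
      (use m in \<open>auto intro: prob_space_PiM N\<close>)
  have exp_g: "P.expectation (\<lambda>s. g (s i)) = (\<integral>z. g z \<partial>N)" if "i < m" for i
  proof -
    have "(\<integral>z. g z \<partial>N) = (\<integral>z. g z \<partial>distr P N (\<lambda>s. s i))" by (simp add: distr_coord that)
    also have "\<dots> = P.expectation (\<lambda>s. g (s i))"
      by (rule integral_distr[OF coord[OF that]]) simp
    finally show ?thesis by simp
  qed
  interpret H: Hoeffding_ineq P "{..<m}" "\<lambda>i s. g (s i)" "\<lambda>_. -1" "\<lambda>_. 1"
    "\<Sum>i<m. P.expectation (\<lambda>s. g (s i))"
  proof unfold_locales
    fix i assume i: "i \<in> {..<m}"
    show "AE s in P. g (s i) \<in> {-1..1}"
    proof (rule AE_I2)
      fix s assume "s \<in> space P"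
      then have "s i \<in> space N" using i measurable_space[OF coord, of i s] by auto
      from g[OF this] show "g (s i) \<in> {-1..1}" by auto
    qed
  qed (use ind in auto)
  \<comment> \<open>Both sums are compared with the threshold m \<tau>: outside \<open>?good\<close>
    either the \<open>g\<close>-sum is at most m \<tau>, or the \<open>h\<close>-sum exceeds
    it.\<close>
  let ?G = "{s \<in> space P. (\<Sum>i<m. g (s i)) \<le> real m * \<tau>}"
  let ?H = "{s \<in> space P. real m * \<tau> \<le> (\<Sum>i<m. h (s i))}"
  let ?good = "{s \<in> space P. (\<Sum>i<m. h (s i)) \<le> (\<Sum>i<m. g (s i))}"
  have sets [measurable]: "?G \<in> sets P" "?H \<in> sets P" "?good \<in> sets P"
    by measurable
  have G: "P.prob ?G \<le> exp (- (real m * (a - \<tau>)\<^sup>2 / 2))"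
  proof -
    \<comment> \<open>The deviation of the threshold from the exact mean of the
      \<open>g\<close>-sum. Only its lower bound m (a - \<tau>) is known. Each term ranges over an
      interval of length 2, so the Hoeffding exponent is -2 \<epsilon>^2 / (4 m).\<close>
    define \<epsilon> where "\<epsilon> = real m * (\<integral>z. g z \<partial>N) - real m * \<tau>"
    have \<epsilon>: "real m * (a - \<tau>) \<le> \<epsilon>" using a m by (simp add: \<epsilon>_def algebra_simps)
    have "0 \<le> real m * (a - \<tau>)" using \<tau> by simp
    then have "(real m * (a - \<tau>))\<^sup>2 \<le> \<epsilon>\<^sup>2" using \<epsilon> by (intro power_mono) auto
    then have "real m * (a - \<tau>)\<^sup>2 / 2 \<le> \<epsilon>\<^sup>2 / (2 * real m)"
      using m by (simp add: field_simps power2_eq_square)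
    moreover have "P.prob {s \<in> space P. (\<Sum>i<m. g (s i)) \<le> (\<Sum>i<m. P.expectation (\<lambda>s. g (s i))) - \<epsilon>}
       \<le> exp (-2 * \<epsilon>\<^sup>2 / (\<Sum>i<m. (1 - (-1))\<^sup>2))"
      by (rule H.Hoeffding_ineq_le) (use \<epsilon> \<open>0 \<le> real m * (a - \<tau>)\<close> m in auto)
    moreover have "(\<Sum>i<m. P.expectation (\<lambda>s. g (s i))) - \<epsilon> = real m * \<tau>"
      by (simp add: exp_g \<epsilon>_def)
    moreover have "-2 * \<epsilon>\<^sup>2 / (\<Sum>i<m. (1 - (-1))\<^sup>2) = - (\<epsilon>\<^sup>2 / (2 * real m))"
      by simp
    ultimately have "P.prob ?G \<le> exp (- (\<epsilon>\<^sup>2 / (2 * real m)))" by (simp only:)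
    also have "\<dots> \<le> exp (- (real m * (a - \<tau>)\<^sup>2 / 2))"
      using \<open>real m * (a - \<tau>)\<^sup>2 / 2 \<le> \<epsilon>\<^sup>2 / (2 * real m)\<close> by simp
    finally show ?thesis .
  qed
  \<comment> \<open>Markov's inequality in \<open>ennreal\<close>: the mean of the
    \<open>h\<close>-sum is at most m b, and division by the threshold m \<tau> cancels m.\<close>
  have H: "P.prob ?H \<le> b / \<tau>"
  proof -
    have int_h: "(\<integral>\<^sup>+s. ennreal (h (s i)) \<partial>P) = (\<integral>\<^sup>+z. ennreal (h z) \<partial>N)" if "i < m" for i
    proof -
      have "(\<integral>\<^sup>+z. ennreal (h z) \<partial>N) = (\<integral>\<^sup>+z. ennreal (h z) \<partial>distr P N (\<lambda>s. s i))"
        by (simp add: distr_coord that)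
      also have "\<dots> = (\<integral>\<^sup>+s. ennreal (h (s i)) \<partial>P)"
        by (rule nn_integral_distr[OF coord[OF that]]) simp
      finally show ?thesis by simp
    qed
    have h_nonneg: "0 \<le> h (s i)" if "s \<in> space P" "i < m" for s i
      using that measurable_space[OF coord, of i s] by (intro h) auto
    have pos: "0 < real m * \<tau>" using m \<tau> by simp
    have "emeasure P ?H \<le> emeasure P {s \<in> space P. 1 \<le> ennreal (1 / (real m * \<tau>)) * (\<Sum>i<m. ennreal (h (s i)))}"
    proof (rule emeasure_mono)
      show "?H \<subseteq> {s \<in> space P. 1 \<le> ennreal (1 / (real m * \<tau>)) * (\<Sum>i<m. ennreal (h (s i)))}"
      proof safe
        fix s assume s: "s \<in> space P" "real m * \<tau> \<le> (\<Sum>i<m. h (s i))"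
        have "(\<Sum>i<m. ennreal (h (s i))) = ennreal (\<Sum>i<m. h (s i))"
          using s h_nonneg by (intro sum_ennreal) auto
        then have "ennreal (1 / (real m * \<tau>)) * (\<Sum>i<m. ennreal (h (s i)))
           = ennreal (1 / (real m * \<tau>) * (\<Sum>i<m. h (s i)))"
          using pos by (simp only:) (rule ennreal_mult'[symmetric], simp)
        also have "1 \<le> \<dots>"
          using s pos by (simp add: ennreal_ge_1 field_simps)
        finally show "1 \<le> ennreal (1 / (real m * \<tau>)) * (\<Sum>i<m. ennreal (h (s i)))" .
      qed
    qed measurable
    also have "\<dots> \<le> ennreal (1 / (real m * \<tau>)) * (\<integral>\<^sup>+s. (\<Sum>i<m. ennreal (h (s i))) * indicator (space P) s \<partial>P)"
      by (rule nn_integral_Markov_inequality) measurable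
    also have "(\<integral>\<^sup>+s. (\<Sum>i<m. ennreal (h (s i))) * indicator (space P) s \<partial>P)
       = (\<integral>\<^sup>+s. (\<Sum>i<m. ennreal (h (s i))) \<partial>P)"
      by (intro nn_integral_cong) auto
    also have "\<dots> = (\<Sum>i<m. \<integral>\<^sup>+s. ennreal (h (s i)) \<partial>P)"
      by (rule nn_integral_sum) measurable
    also have "\<dots> = ennreal (real m) * (\<integral>\<^sup>+z. ennreal (h z) \<partial>N)"
      by (simp add: int_h ennreal_of_nat_eq_real_of_nat)
    also have "ennreal (1 / (real m * \<tau>)) * (ennreal (real m) * (\<integral>\<^sup>+z. ennreal (h z) \<partial>N))
       \<le> ennreal (1 / (real m * \<tau>)) * (ennreal (real m) * ennreal b)"
      by (intro mult_left_mono b) auto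
    also have "\<dots> = ennreal (b / \<tau>)"
      using m b \<tau> by (simp add: ennreal_mult'[symmetric] less_imp_le)
    finally show ?thesis
      using b \<tau> by (simp add: P.emeasure_eq_measure)
  qed
  have "1 = P.prob (space P)" by (simp add: P.prob_space)
  also have "\<dots> \<le> P.prob (?good \<union> (?G \<union> ?H))"
    by (rule P.finite_measure_mono) auto
  also have "\<dots> \<le> P.prob ?good + (P.prob ?G + P.prob ?H)"
    by (intro order_trans[OF measure_Un_le] add_left_mono measure_Un_le) auto
  finally show ?thesis using G H by linarith
qed

subsection \<open>The clean error as a product measure\<close>

lemma sets_D_x [measurable_cong, simp]: "sets (D_x d \<mu>) = sets (lborel_d d)"
  by (simp add: D_x_def)

lemma space_D_x [simp]: "space (D_x d \<mu>) = space (lborel_d d)"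
  by (simp add: D_x_def)

lemma prob_space_D_x:
  assumes "is_prob_density d \<mu>"
  shows "prob_space (D_x d \<mu>)"
proof
  have [measurable]: "\<mu> \<in> borel_measurable (lborel_d d)"
    using assms by (simp add: is_prob_density_def)
  have "emeasure (D_x d \<mu>) (space (D_x d \<mu>)) = (\<integral>\<^sup>+ x. ennreal (\<mu> x) * indicator (space (lborel_d d)) x \<partial>lborel_d d)"
    unfolding D_x_def by (subst emeasure_density) auto
  also have "\<dots> = (\<integral>\<^sup>+ x. ennreal (\<mu> x) \<partial>lborel_d d)"
    by (intro nn_integral_cong) auto
  finally show "emeasure (D_x d \<mu>) (space (D_x d \<mu>)) = 1"
    using assms by (simp add: is_prob_density_def)
qed

lemma null_sets_D_x:
  assumes "is_prob_density d \<mu>" "X \<in> null_sets (lborel_d d)"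
  shows "X \<in> null_sets (D_x d \<mu>)"
proof -
  have "\<mu> \<in> borel_measurable (lborel_d d)"
    using assms by (simp add: is_prob_density_def)
  then have "(\<lambda>x. ennreal (\<mu> x)) \<in> borel_measurable (lborel_d d)" by measurable
  moreover have "AE x in lborel_d d. x \<notin> X" by (rule AE_not_in) fact
  ultimately show ?thesis
    using assms unfolding D_x_def by (subst null_sets_density_iff) (auto elim: eventually_mono)
qed

text \<open>Each point lies on the unit sphere around its own translate along coordinate 0, and
  spheres are null sets.\<close>

lemma null_sets_finite:
  assumes "0 < d" "finite X" "X \<subseteq> space (lborel_d d)"
  shows "X \<in> null_sets (lborel_d d)"
proof -
  have "{x} \<in> null_sets (lborel_d d)" if x: "x \<in> space (lborel_d d)" for x
  proof (rule null_sets_subset)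
    let ?x' = "x(0 := x 0 + 1)"
    show "{z \<in> space (lborel_d d). euclid_dist d ?x' z = 1} \<in> null_sets (lborel_d d)"
      using assms by (intro null_sets_sphere) auto
    have "(\<Sum>i<d. (?x' i - x i)\<^sup>2) = (\<Sum>i<d. if i = 0 then 1 else 0)"
      by (intro sum.cong) auto
    then have "euclid_dist d ?x' x = 1"
      using assms by (simp add: euclid_dist_def)
    then show "{x} \<subseteq> {z \<in> space (lborel_d d). euclid_dist d ?x' z = 1}"
      using x by auto
    have "{x} = {z \<in> space (lborel_d d). euclid_dist d x z = 0}"
      using x euclid_dist_eq_0_iff[of x d] by auto
    moreover have "\<dots> \<in> sets (lborel_d d)" using x by measurable
    ultimately show "{x} \<in> sets (lborel_d d)" by simp
  qed
  then have "(\<Union>x\<in>X. {x}) \<in> null_sets (lborel_d d)"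
    using assms by (intro null_sets_UN') (auto intro: countable_finite)
  then show ?thesis by simp
qed

text \<open>The sample points form a null set, so the interpolation rule at the sample points can be
  ignored; it is not needed to check that \<open>nw_pred\<close> itself is jointly measurable.\<close>
lemma clean_error_ge:
  assumes \<mu>: "is_prob_density d \<mu>" and f: "is_target d f" and "0 < d"
    and B [measurable]: "B \<in> sets (lborel_d d)" and c: "0 \<le> c"
    and ge: "\<And>x. x \<in> B \<Longrightarrow> c \<le> measure (sample_measure d \<mu> p m) {s \<in> space (sample_measure d \<mu> p m).
        sgn (\<Sum>i<m. noisy_label f s i * euclid_dist d x (fst (s i)) powr (-\<beta>)) \<noteq> f x}"
  shows "c * measure (D_x d \<mu>) B \<le> clean_error d \<mu> f \<beta> p m"
proof -
  define D where "D = D_x d \<mu>"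
  define N where "N = D \<Otimes>\<^sub>M measure_pmf (bernoulli_pmf p)"
  define P where "P = PiM {..<m} (\<lambda>_. N)"
  define S where "S s x = (\<Sum>i<m. noisy_label f s i * euclid_dist d x (fst (s i)) powr (-\<beta>))" for s x
  have P_eq: "sample_measure d \<mu> p m = P"
    by (simp add: P_def N_def D_def sample_measure_def)
  have [measurable_cong, simp]: "sets D = sets (lborel_d d)" by (simp add: D_def)
  have [simp]: "space D = space (lborel_d d)" by (simp add: D_def)
  have [measurable]: "f \<in> borel_measurable (lborel_d d)" using f by (simp add: is_target_def)
  interpret D: prob_space D unfolding D_def by (rule prob_space_D_x) fact
  interpret DB: pair_prob_space D "measure_pmf (bernoulli_pmf p)" ..
  have N: "prob_space N" unfolding N_def by (rule DB.prob_space_axioms)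
  interpret P: prob_space P unfolding P_def by (rule prob_space_PiM) (rule N)
  interpret PD: pair_prob_space P D ..
  have [measurable]: "(\<lambda>s. s i) \<in> measurable P N" if "i < m" for i
    unfolding P_def using that by simp
  have fst_N [measurable]: "fst \<in> measurable N (lborel_d d)"
    unfolding N_def by measurable
  have [measurable]: "snd \<in> measurable N (count_space UNIV)"
    unfolding N_def by measurable
  have point: "fst (s i) \<in> space (lborel_d d)" if "s \<in> space P" "i < m" for s i
    using that by (intro measurable_space[OF fst_N]) (auto simp: P_def space_PiM)
  \<comment> \<open>The joint error event of the pure kernel vote, over sample and test point
    together. Its two families of slices give the error for a fixed sample and the error probability
    at a fixed test point.\<close>
  define A where "A = {w \<in> space (P \<Otimes>\<^sub>M D). sgn (S (fst w) (snd w)) \<noteq> f (snd w)}"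
  have A [measurable]: "A \<in> sets (P \<Otimes>\<^sub>M D)"
    unfolding A_def S_def noisy_label_def by measurable
  have slice: "Pair s -` A = {x \<in> space D. sgn (S s x) \<noteq> f x}" if "s \<in> space P" for s
    using that by (auto simp: A_def space_pair_measure)
  have slice': "(\<lambda>s. (s, x)) -` A = {s \<in> space P. sgn (S s x) \<noteq> f x}" if "x \<in> space D" for x
    using that by (auto simp: A_def space_pair_measure)

  have eq: "measure D {x \<in> space D. nw_pred d \<beta> m (\<lambda>i. fst (s i)) (noisy_label f s) x \<noteq> f x}
      = measure D (Pair s -` A)" if s: "s \<in> space P" for s
  proof -
    let ?X = "(\<lambda>i. fst (s i)) ` {..<m}"
    let ?E = "{x \<in> space D. nw_pred d \<beta> m (\<lambda>i. fst (s i)) (noisy_label f s) x \<noteq> f x}"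
    have null: "Y \<in> null_sets D" if "Y \<subseteq> ?X" for Y
      unfolding D_def using that point[OF s] \<open>0 < d\<close>
      by (intro null_sets_D_x \<mu> null_sets_finite) (auto intro: finite_subset)
    have off: "nw_pred d \<beta> m (\<lambda>i. fst (s i)) (noisy_label f s) x = sgn (S s x)" if "x \<notin> ?X" for x
      using that by (auto simp: nw_pred_def S_def)
    have E2: "Pair s -` A \<in> sets D" by (rule sets_Pair1[OF A])
    \<comment> \<open>The true error set differs from the slice only within the finite set of sample
      points, every subset of which is null and hence measurable.\<close>
    have "?E = (Pair s -` A - ?X) \<union> (?E \<inter> ?X)"
      using off unfolding slice[OF s] by auto
    also have "\<dots> \<in> sets D"
      using null[of ?X] null[of "?E \<inter> ?X"] E2 by (intro sets.Un sets.Diff) auto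
    finally have "?E \<in> sets D" .
    moreover have "AE x in D. x \<in> ?E \<longleftrightarrow> x \<in> Pair s -` A"
      using AE_not_in[OF null[OF order_refl]]
      by eventually_elim (use off in \<open>auto simp: slice[OF s]\<close>)
    ultimately show ?thesis using E2 by (intro measure_eq_AE) auto
  qed
  have "clean_error d \<mu> f \<beta> p m = (\<integral>s. measure D (Pair s -` A) \<partial>P)"
    unfolding clean_error_def P_eq D_def[symmetric]
    by (intro Bochner_Integration.integral_cong refl eq)
  also have "\<dots> = enn2real (\<integral>\<^sup>+s. ennreal (measure D (Pair s -` A)) \<partial>P)"
    using D.measurable_emeasure_Pair[OF A]
    by (intro integral_eq_nn_integral) (auto simp: measure_def)
  also have "(\<integral>\<^sup>+s. ennreal (measure D (Pair s -` A)) \<partial>P) = emeasure (P \<Otimes>\<^sub>M D) A"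
    by (simp only: D.emeasure_eq_measure[symmetric] D.emeasure_pair_measure_alt[OF A])
  also have "enn2real \<dots> = measure (P \<Otimes>\<^sub>M D) A" by (simp add: measure_def)
  finally have error: "clean_error d \<mu> f \<beta> p m = measure (P \<Otimes>\<^sub>M D) A" .
  \<comment> \<open>Now the other order of integration: the sample is averaged first at each fixed
    test point, where the hypothesis on \<open>B\<close> applies.\<close>
  have "ennreal (c * measure D B) = (\<integral>\<^sup>+x. ennreal c * indicator B x \<partial>D)"
    using c by (simp add: nn_integral_cmult_indicator ennreal_mult' D.emeasure_eq_measure)
  also have "\<dots> \<le> (\<integral>\<^sup>+x. emeasure P ((\<lambda>s. (s, x)) -` A) \<partial>D)"
  proof (rule nn_integral_mono)
    fix x assume x: "x \<in> space D"
    show "ennreal c * indicator B x \<le> emeasure P ((\<lambda>s. (s, x)) -` A)"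
      using ge[of x] slice'[OF x]
      by (auto simp: indicator_def P_eq S_def[symmetric] P.emeasure_eq_measure intro!: ennreal_leI)
  qed
  also have "\<dots> = emeasure (P \<Otimes>\<^sub>M D) A" by (rule PD.emeasure_pair_measure_alt2[symmetric]) (rule A)
  also have "\<dots> = ennreal (clean_error d \<mu> f \<beta> p m)"
    by (simp add: error PD.emeasure_eq_measure)
  finally show ?thesis
    by (subst (asm) ennreal_le_iff) (auto simp: error D_def[symmetric])
qed

subsection \<open>The core-shell distribution\<close>

definition core :: "nat \<Rightarrow> (nat \<Rightarrow> real) set" where
  "core d = dball d (\<lambda>_. 0) 1"

text \<open>The gap between radii 1 and 2 keeps shell points at distance at least 1 from the core,
  so that their votes there are bounded by 1.\<close>

definition shell :: "nat \<Rightarrow> (nat \<Rightarrow> real) set" where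
  "shell d = dball d (\<lambda>_. 0) 3 - dball d (\<lambda>_. 0) 2"

text \<open>The coefficients are the masses \<alpha> and 1 - \<alpha> divided by the volumes of the
  two pieces.\<close>

definition core_shell_density :: "nat \<Rightarrow> real \<Rightarrow> (nat \<Rightarrow> real) \<Rightarrow> real" where
  "core_shell_density d \<alpha> x =
     \<alpha> / unit_ball_vol (real d) * indicator (core d) x
     + (1 - \<alpha>) / (unit_ball_vol (real d) * (3 ^ d - 2 ^ d)) * indicator (shell d) x"

definition core_target :: "nat \<Rightarrow> (nat \<Rightarrow> real) \<Rightarrow> real" where
  "core_target d x = (if x \<in> core d then -1 else 1)"

lemma sets_core [measurable]: "core d \<in> sets (lborel_d d)"
  by (simp add: core_def)

lemma sets_shell [measurable]: "shell d \<in> sets (lborel_d d)"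
  unfolding shell_def by (intro sets.Diff sets_dball)

lemma core_disjoint_shell: "x \<in> core d \<Longrightarrow> x \<notin> shell d"
  using dball_mono[of 1 2 d "\<lambda>_. 0"] by (auto simp: core_def shell_def)

lemma indicator_core_shell:
  "indicator (core d) x * indicator (core d) x = (indicator (core d) x :: ennreal)"
  "indicator (shell d) x * indicator (shell d) x = (indicator (shell d) x :: ennreal)"
  "indicator (core d) x * indicator (shell d) x = (0 :: ennreal)"
  "indicator (shell d) x * indicator (core d) x = (0 :: ennreal)"
  by (auto simp: indicator_def core_disjoint_shell)

lemma emeasure_core: "emeasure (lborel_d d) (core d) = ennreal (unit_ball_vol (real d))"
  by (simp add: core_def emeasure_dball)

lemma emeasure_shell:
  "emeasure (lborel_d d) (shell d) = ennreal (unit_ball_vol (real d) * (3 ^ d - 2 ^ d))"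
proof -
  have "emeasure (lborel_d d) (shell d)
      = emeasure (lborel_d d) (dball d (\<lambda>_. 0) 3) - emeasure (lborel_d d) (dball d (\<lambda>_. 0) 2)"
    unfolding shell_def by (intro emeasure_Diff sets_dball dball_mono) (auto simp: emeasure_dball)
  then show ?thesis
    by (simp add: emeasure_dball ennreal_minus algebra_simps)
qed

text \<open>Triangle inequality through the origin: 2 - 1 from below and 1 + 3 from above.\<close>

lemma euclid_dist_core_shell:
  assumes "x \<in> core d" "z \<in> shell d"
  shows "1 \<le> euclid_dist d x z" "euclid_dist d x z \<le> 4"
proof -
  have x: "euclid_dist d (\<lambda>_. 0) x \<le> 1" and z: "2 < euclid_dist d (\<lambda>_. 0) z" "euclid_dist d (\<lambda>_. 0) z \<le> 3"
    using assms by (auto simp: core_def shell_def dball_def)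
  show "1 \<le> euclid_dist d x z"
    using euclid_dist_triangle[of d "\<lambda>_. 0" z x] x z by linarith
  show "euclid_dist d x z \<le> 4"
    using euclid_dist_triangle[of d x z "\<lambda>_. 0"] x z euclid_dist_commute[of d x "\<lambda>_. 0"] by linarith
qed

lemma is_target_core: "is_target d (core_target d)"
proof -
  have "core_target d \<in> borel_measurable (lborel_d d)"
    unfolding core_target_def by measurable
  then show ?thesis by (auto simp: is_target_def core_target_def)
qed

lemma unit_ball_vol_neq_0 [simp]: "unit_ball_vol (real d) \<noteq> 0"
  by (rule less_imp_neq[symmetric], rule unit_ball_vol_pos) simp

context
  fixes d :: nat and \<alpha> :: real
  assumes d: "0 < d" and \<alpha>: "0 < \<alpha>" "\<alpha> < 1"
begin

lemma shell_vol_pos: "0 < unit_ball_vol (real d) * (3 ^ d - 2 ^ d)"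
  using d by (intro mult_pos_pos) (auto intro!: power_strict_mono)

lemma measurable_core_shell_density [measurable]:
  "core_shell_density d \<alpha> \<in> borel_measurable (lborel_d d)"
  unfolding core_shell_density_def by measurable

text \<open>The two pieces are disjoint, so the density splits into two uniform parts. The total
  mass, the masses of the pieces and the mean core vote are all computed from this.\<close>

lemma nn_integral_D_x_core_shell:
  assumes [measurable]: "h \<in> borel_measurable (lborel_d d)"
  shows "(\<integral>\<^sup>+z. h z \<partial>D_x d (core_shell_density d \<alpha>))
    = ennreal (\<alpha> / unit_ball_vol (real d)) * (\<integral>\<^sup>+z. h z * indicator (core d) z \<partial>lborel_d d)
    + ennreal ((1 - \<alpha>) / (unit_ball_vol (real d) * (3 ^ d - 2 ^ d)))
        * (\<integral>\<^sup>+z. h z * indicator (shell d) z \<partial>lborel_d d)"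
proof -
  let ?a = "\<alpha> / unit_ball_vol (real d)"
  let ?b = "(1 - \<alpha>) / (unit_ball_vol (real d) * (3 ^ d - 2 ^ d))"
  have nonneg: "0 \<le> ?a" "0 \<le> ?b"
    using \<alpha> shell_vol_pos by (auto intro!: divide_nonneg_nonneg simp: less_imp_le)
  have "(\<integral>\<^sup>+z. h z \<partial>D_x d (core_shell_density d \<alpha>))
      = (\<integral>\<^sup>+z. ennreal (core_shell_density d \<alpha> z) * h z \<partial>lborel_d d)"
    unfolding D_x_def by (rule nn_integral_density) measurable
  also have "\<dots> = (\<integral>\<^sup>+z. ennreal ?a * (h z * indicator (core d) z)
      + ennreal ?b * (h z * indicator (shell d) z) \<partial>lborel_d d)"
    by (intro nn_integral_cong)
      (auto simp: core_shell_density_def indicator_def core_disjoint_shell mult.commute)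
  also have "\<dots> = (\<integral>\<^sup>+z. ennreal ?a * (h z * indicator (core d) z) \<partial>lborel_d d)
      + (\<integral>\<^sup>+z. ennreal ?b * (h z * indicator (shell d) z) \<partial>lborel_d d)"
    by (rule nn_integral_add) measurable
  finally show ?thesis by (simp add: nn_integral_cmult)
qed

lemma is_prob_density_core_shell: "is_prob_density d (core_shell_density d \<alpha>)"
proof -
  let ?V = "unit_ball_vol (real d)" and ?W = "unit_ball_vol (real d) * (3 ^ d - 2 ^ d)"
  have "(\<integral>\<^sup>+ x. ennreal (core_shell_density d \<alpha> x) \<partial>lborel_d d)
      = (\<integral>\<^sup>+ x. 1 \<partial>D_x d (core_shell_density d \<alpha>))"
    unfolding D_x_def by (subst nn_integral_density) auto
  also have "\<dots> = ennreal (\<alpha> / ?V) * ennreal ?V + ennreal ((1 - \<alpha>) / ?W) * ennreal ?W"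
    by (subst nn_integral_D_x_core_shell) (auto simp: emeasure_core emeasure_shell)
  also have "\<dots> = ennreal (\<alpha> / ?V * ?V) + ennreal ((1 - \<alpha>) / ?W * ?W)"
    using \<alpha> shell_vol_pos by (intro arg_cong2[where f = "(+)"] ennreal_mult'[symmetric]) auto
  also have "\<dots> = 1"
  proof -
    have "\<alpha> / ?V * ?V = \<alpha>" by simp
    moreover have "(1 - \<alpha>) / ?W * ?W = 1 - \<alpha>"
      using shell_vol_pos by (subst nonzero_eq_divide_eq[symmetric]) auto
    ultimately show ?thesis
      using \<alpha> by (simp only:) (subst ennreal_plus[symmetric], auto)
  qed
  finally show ?thesis
    using \<alpha> shell_vol_pos
    by (auto simp: is_prob_density_def core_shell_density_def[of d \<alpha> x for x] intro!: add_nonneg_nonneg mult_nonneg_nonneg divide_nonneg_nonneg)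
qed

lemma measure_D_x_core: "measure (D_x d (core_shell_density d \<alpha>)) (core d) = \<alpha>"
proof -
  have "emeasure (D_x d (core_shell_density d \<alpha>)) (core d)
      = (\<integral>\<^sup>+z. indicator (core d) z \<partial>D_x d (core_shell_density d \<alpha>))"
    by simp
  also have "\<dots> = ennreal (\<alpha> / unit_ball_vol (real d)) * (\<integral>\<^sup>+z. indicator (core d) z \<partial>lborel_d d) + 0"
    by (subst nn_integral_D_x_core_shell, measurable) (simp only: indicator_core_shell nn_integral_const mult_zero_left mult_zero_right)
  also have "\<dots> = ennreal \<alpha>"
    using \<alpha> unit_ball_vol_pos[of "real d"] by (simp add: emeasure_core ennreal_mult'[symmetric])
  finally show ?thesis using \<alpha> by (simp add: measure_def)
qed

lemma measure_D_x_shell: "measure (D_x d (core_shell_density d \<alpha>)) (shell d) = 1 - \<alpha>"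
proof -
  have "emeasure (D_x d (core_shell_density d \<alpha>)) (shell d)
      = (\<integral>\<^sup>+z. indicator (shell d) z \<partial>D_x d (core_shell_density d \<alpha>))"
    by simp
  also have "\<dots> = 0 + ennreal ((1 - \<alpha>) / (unit_ball_vol (real d) * (3 ^ d - 2 ^ d)))
      * (\<integral>\<^sup>+z. indicator (shell d) z \<partial>lborel_d d)"
    by (subst nn_integral_D_x_core_shell, measurable) (simp only: indicator_core_shell nn_integral_const mult_zero_left mult_zero_right)
  also have "\<dots> = ennreal (1 - \<alpha>)"
    using \<alpha> shell_vol_pos less_imp_neq[OF shell_vol_pos]
    by (simp add: emeasure_shell ennreal_mult'[symmetric])
  finally show ?thesis using \<alpha> by (simp add: measure_def)
qed

text \<open>Density and target are locally constant off the spheres of radii 1, 2 and 3, which are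
  null sets.\<close>

lemma regularity_core_shell: "regularity d (core_shell_density d \<alpha>) (core_target d)"
proof -
  let ?r = "euclid_dist d (\<lambda>_. 0)"
  have "AE x in lborel_d d. ?r x \<noteq> k" if "0 < k" for k
    using AE_not_in[OF null_sets_sphere[OF that d, of "\<lambda>_. 0"]] AE_space
    by eventually_elim auto
  from this[OF zero_less_one] this[OF zero_less_numeral] this[OF zero_less_numeral]
  have "AE x in lborel_d d. ?r x \<noteq> 1" "AE x in lborel_d d. ?r x \<noteq> 2" "AE x in lborel_d d. ?r x \<noteq> 3"
    by this+
  then have "AE x in lborel_d d. \<exists>\<delta>>0. \<forall>y\<in>space (lborel_d d). euclid_dist d x y < \<delta> \<longrightarrow>
      core_shell_density d \<alpha> y = core_shell_density d \<alpha> x \<and> core_target d y = core_target d x"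
    using AE_space
  proof eventually_elim
    case (elim x)
    \<comment> \<open>The distance from the radius of \<open>x\<close> to the nearest of the three
      jump radii: a move shorter than this changes the radius by less than \<delta> and crosses no
      jump.\<close>
    define \<delta> where "\<delta> = min \<bar>?r x - 1\<bar> (min \<bar>?r x - 2\<bar> \<bar>?r x - 3\<bar>)"
    have "0 < \<delta>" using elim by (auto simp: \<delta>_def)
    moreover have "(y \<in> core d \<longleftrightarrow> x \<in> core d) \<and> (y \<in> shell d \<longleftrightarrow> x \<in> shell d)"
      if y: "y \<in> space (lborel_d d)" "euclid_dist d x y < \<delta>" for y
    proof -
      have "\<bar>?r y - ?r x\<bar> < \<delta>"
        using euclid_dist_triangle[of d "\<lambda>_. 0" x y] euclid_dist_triangle[of d "\<lambda>_. 0" y x]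
          euclid_dist_commute[of d x y] y by linarith
      then show ?thesis
        using y elim(4) by (auto simp: core_def shell_def dball_def \<delta>_def)
    qed
    ultimately show ?case
      by (intro exI[of _ \<delta>]) (auto simp: core_shell_density_def core_target_def indicator_def)
  qed
  then show ?thesis
    unfolding regularity_def by (auto elim!: eventually_mono)
qed

end

section \<open>Error probability at a fixed core point, and the resulting lower bound\<close>

lemma core_error_prob:
  fixes d m :: nat and \<beta> p :: real
  assumes \<beta>: "0 < \<beta>" "\<beta> < real d" and p: "0 < p" "p < 49/100" and m: "0 < m"
    and x: "x \<in> core d"
  defines "\<alpha> \<equiv> (1/8) powr \<beta> * (1 - \<beta> / real d) / 1000"
  defines "P \<equiv> sample_measure d (core_shell_density d \<alpha>) p m"
  shows "7/10 - exp (- (real m * (9/1000 * (1/4) powr \<beta>)\<^sup>2 / 2))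
    \<le> measure P {s \<in> space P. sgn (\<Sum>i<m. noisy_label (core_target d) s i
          * euclid_dist d x (fst (s i)) powr (-\<beta>)) \<noteq> core_target d x}"
proof -
  have d: "0 < d" using \<beta> by (cases d) auto
  define \<gamma> where "\<gamma> = 1 - \<beta> / real d"
  have \<gamma>: "0 < \<gamma>" "\<gamma> < 1" using \<beta> d by (auto simp: \<gamma>_def field_simps)
  have "(1/8) powr \<beta> \<le> (1::real)" using \<beta> by (intro powr_le1) auto
  then have \<alpha>: "0 < \<alpha>" "\<alpha> \<le> 1/1000"
    using \<gamma> mult_mono[of "(1/8) powr \<beta>" 1 \<gamma> 1] by (auto simp: \<alpha>_def \<gamma>_def[symmetric])
  then have \<alpha>': "\<alpha> < 1" by simp
  note dens = is_prob_density_core_shell[OF d \<alpha>(1) \<alpha>']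
  define D where "D = D_x d (core_shell_density d \<alpha>)"
  define N where "N = D \<Otimes>\<^sub>M measure_pmf (bernoulli_pmf p)"
  have P_eq: "P = PiM {..<m} (\<lambda>_. N)"
    by (simp add: P_def N_def D_def sample_measure_def)
  have [measurable_cong, simp]: "sets D = sets (lborel_d d)" by (simp add: D_def)
  have [simp]: "space D = space (lborel_d d)" by (simp add: D_def)
  interpret D: prob_space D unfolding D_def by (rule prob_space_D_x) (rule dens)
  interpret DB: pair_prob_space D "measure_pmf (bernoulli_pmf p)" ..
  have N: "prob_space N" unfolding N_def by (rule DB.prob_space_axioms)
  interpret P: prob_space P unfolding P_eq by (rule prob_space_PiM) (rule N)
  have xs: "x \<in> space (lborel_d d)" using x by (simp add: core_def dball_def)
  define w where "w z = euclid_dist d x z powr (-\<beta>)" for z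
  have w_meas [measurable]: "w \<in> borel_measurable (lborel_d d)"
    unfolding w_def using xs by measurable
  have w_shell: "(1/4) powr \<beta> \<le> w z" "w z \<le> 1" if "z \<in> shell d" for z
  proof -
    note r = euclid_dist_core_shell[OF x that]
    have "(1/4) powr \<beta> = 4 powr (-\<beta>)" by (simp add: powr_divide powr_minus_divide)
    also have "\<dots> \<le> w z" unfolding w_def using r \<beta> by (intro powr_mono2') auto
    finally show "(1/4) powr \<beta> \<le> w z" .
    have "w z \<le> 1 powr (-\<beta>)" unfolding w_def using r \<beta> by (intro powr_mono2') auto
    then show "w z \<le> 1" by simp
  qed
  \<comment> \<open>The vote at \<open>x\<close> is split by the position of the sample point.
    \<open>g\<close> is the signed vote of a shell point, whose clean label is 1; \<open>h\<close>
    charges every other point its full weight, as if it always voted for the correct label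
    -1.\<close>
  define g where "g zb = (if fst zb \<in> shell d then (if snd zb then -1 else 1) * w (fst zb) else 0)"
    for zb :: "(nat \<Rightarrow> real) \<times> bool"
  define h where "h zb = (if fst zb \<in> shell d then 0 else w (fst zb))"
    for zb :: "(nat \<Rightarrow> real) \<times> bool"
  have [measurable]: "fst \<in> measurable N (lborel_d d)"
    unfolding N_def by measurable
  have [measurable]: "snd \<in> measurable N (count_space UNIV)"
    unfolding N_def by measurable
  have g_meas [measurable]: "g \<in> borel_measurable N" unfolding g_def by measurable
  have h_meas [measurable]: "h \<in> borel_measurable N" unfolding h_def by measurable
  have g_bound: "\<bar>g zb\<bar> \<le> 1" for zb
    using w_shell[of "fst zb"] by (auto simp: g_def w_def abs_mult)

  have g_mean: "19/1000 * (1/4) powr \<beta> \<le> (\<integral>zb. g zb \<partial>N)"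
  proof -
    interpret N: prob_space N by fact
    have int: "integrable N g"
      by (rule N.integrable_const_bound[where B = 1]) (use g_bound in auto)
    have int_w: "integrable D (\<lambda>z. w z * indicator (shell d) z)"
    proof (rule D.integrable_const_bound[where B = 1])
      show "AE z in D. norm (w z * indicator (shell d) z) \<le> 1"
        using w_shell by (intro AE_I2) (auto simp: indicator_def w_def)
    qed measurable
    \<comment> \<open>Averaging over the label flip first multiplies the weight by (1 - p) - p = 1 -
      2 p.\<close>
    have "(\<integral>zb. g zb \<partial>N) = (\<integral>z. (\<integral>b. g (z, b) \<partial>measure_pmf (bernoulli_pmf p)) \<partial>D)"
      using int unfolding N_def by (subst DB.integral_fst) auto
    also have "\<dots> = (\<integral>z. (1 - 2 * p) * (w z * indicator (shell d) z) \<partial>D)"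
      using p by (intro Bochner_Integration.integral_cong) (auto simp: g_def algebra_simps)
    also have "\<dots> = (1 - 2 * p) * (\<integral>z. w z * indicator (shell d) z \<partial>D)"
      by simp
    finally have eq: "(\<integral>zb. g zb \<partial>N) = (1 - 2 * p) * (\<integral>z. w z * indicator (shell d) z \<partial>D)" .
    have "(1/4) powr \<beta> * (1 - \<alpha>) = (\<integral>z. (1/4) powr \<beta> * indicator (shell d) z \<partial>D)"
      using measure_D_x_shell[OF d \<alpha>(1) \<alpha>'] by (simp add: D_def)
    also have "\<dots> \<le> (\<integral>z. w z * indicator (shell d) z \<partial>D)"
    proof (rule integral_mono[OF _ int_w])
      show "integrable D (\<lambda>z. (1/4) powr \<beta> * indicator (shell d) z)"
        by (intro integrable_mult_right integrable_real_indicator) (auto simp: less_top[symmetric])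
    qed (use w_shell in \<open>auto simp: indicator_def\<close>)
    finally have "(1 - 2 * p) * ((1/4) powr \<beta> * (1 - \<alpha>)) \<le> (\<integral>zb. g zb \<partial>N)"
      unfolding eq using p by (intro mult_left_mono) auto
    \<comment> \<open>Here p < 49/100 gives 1 - 2 p \<ge> 2/100, and \<alpha> \<le> 1/1000 gives
      shell mass at least 999/1000; the product 0.01998 is rounded down to 19/1000.\<close>
    moreover have "2/100 * ((1/4) powr \<beta> * (999/1000)) \<le> (1 - 2 * p) * ((1/4) powr \<beta> * (1 - \<alpha>))"
      using p \<alpha> by (intro mult_mono) auto
    moreover have "0 < (1/4::real) powr \<beta>" by simp
    ultimately show ?thesis by linarith
  qed

  have h_mean: "(\<integral>\<^sup>+zb. ennreal (h zb) \<partial>N) \<le> ennreal (3/1000 * (1/4) powr \<beta>)"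
  proof -
    let ?V = "unit_ball_vol (real d)"
    have "(\<integral>\<^sup>+zb. ennreal (h zb) \<partial>N) = (\<integral>\<^sup>+z. (\<integral>\<^sup>+b. ennreal (h (z, b)) \<partial>measure_pmf (bernoulli_pmf p)) \<partial>D)"
      unfolding N_def by (rule measure_pmf.nn_integral_fst[symmetric]) (use h_meas in \<open>simp add: N_def\<close>)
    also have "\<dots> = (\<integral>\<^sup>+z. ennreal (w z) * indicator (- shell d) z \<partial>D)"
      by (intro nn_integral_cong) (auto simp: h_def indicator_def measure_pmf.emeasure_space_1[simplified])
    also have "\<dots> = ennreal (\<alpha> / ?V) * (\<integral>\<^sup>+z. ennreal (w z) * indicator (- shell d) z * indicator (core d) z \<partial>lborel_d d)
       + ennreal ((1 - \<alpha>) / (?V * (3 ^ d - 2 ^ d)))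
        * (\<integral>\<^sup>+z. ennreal (w z) * indicator (- shell d) z * indicator (shell d) z \<partial>lborel_d d)"
      unfolding D_def by (rule nn_integral_D_x_core_shell[OF d \<alpha>(1) \<alpha>']) measurable
    also have "(\<integral>\<^sup>+z. ennreal (w z) * indicator (- shell d) z * indicator (core d) z \<partial>lborel_d d)
       = (\<integral>\<^sup>+z. ennreal (w z) * indicator (core d) z \<partial>lborel_d d)"
      by (intro nn_integral_cong) (auto simp: indicator_def core_disjoint_shell)
    also have "(\<integral>\<^sup>+z. ennreal (w z) * indicator (- shell d) z * indicator (shell d) z \<partial>lborel_d d)
       = (\<integral>\<^sup>+z. 0 \<partial>lborel_d d)"
      by (intro nn_integral_cong) (auto simp: indicator_def)
    also have "ennreal (\<alpha> / ?V) * (\<integral>\<^sup>+z. ennreal (w z) * indicator (core d) z \<partial>lborel_d d)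
       + ennreal ((1 - \<alpha>) / (?V * (3 ^ d - 2 ^ d))) * (\<integral>\<^sup>+z. 0 \<partial>lborel_d d)
       \<le> ennreal (\<alpha> / ?V) * ennreal (?V * (3 * 2 powr \<beta> / \<gamma>))"
      using nn_integral_kernel_unit_ball[OF \<beta>, of x "\<lambda>_. 0"]
      by (simp add: w_def core_def \<gamma>_def mult_left_mono)
    also have "\<dots> = ennreal (\<alpha> / ?V * (?V * (3 * 2 powr \<beta> / \<gamma>)))"
      by (rule ennreal_mult'[symmetric]) (use \<alpha> in auto)
    \<comment> \<open>This is why \<alpha> has its form: the factor 1 - \<beta>/d cancels the
      blow-up of the kernel integral, and 8^-\<beta> times 2^\<beta> is 4^-\<beta>, the scale of the
      shell votes.\<close>
    also have "\<alpha> / ?V * (?V * (3 * 2 powr \<beta> / \<gamma>)) = 3/1000 * ((1/8) powr \<beta> * 2 powr \<beta>)"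
      using \<gamma> unit_ball_vol_pos[of "real d"] by (simp add: \<alpha>_def \<gamma>_def[symmetric])
    also have "(1/8) powr \<beta> * 2 powr \<beta> = (1/4::real) powr \<beta>"
      by (simp flip: powr_mult)
    finally show ?thesis .
  qed

  have pos: "0 < (1/4::real) powr \<beta>" by simp
  let ?good = "{s \<in> space P. (\<Sum>i<m. h (s i)) \<le> (\<Sum>i<m. g (s i))}"
  let ?err = "{s \<in> space P. sgn (\<Sum>i<m. noisy_label (core_target d) s i
          * euclid_dist d x (fst (s i)) powr (-\<beta>)) \<noteq> core_target d x}"
  \<comment> \<open>The threshold \<tau> = (1/100) 4^-\<beta> lies between the two means: Markov's
    term becomes 3/10, and 9/1000 of the scale is left for Hoeffding's.\<close>
  have "1 - 3/1000 * (1/4) powr \<beta> / (1/100 * (1/4) powr \<beta>)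
      - exp (- (real m * (19/1000 * (1/4) powr \<beta> - 1/100 * (1/4) powr \<beta>)\<^sup>2 / 2)) \<le> P.prob ?good"
    unfolding P_eq
    by (rule prob_sum_dominates[OF N g_meas h_meas g_bound _ g_mean h_mean])
      (use pos m in \<open>auto simp: h_def w_def\<close>)
  moreover have "3/1000 * (1/4) powr \<beta> / (1/100 * (1/4) powr \<beta>) = 3/10"
    using pos by simp
  moreover have "19/1000 * (1/4) powr \<beta> - 1/100 * (1/4) powr \<beta> = 9/1000 * (1/4) powr \<beta>"
    by simp
  ultimately have "7/10 - exp (- (real m * (9/1000 * (1/4) powr \<beta>)\<^sup>2 / 2)) \<le> P.prob ?good"
    by simp
  also have "\<dots> \<le> P.prob ?err"
  proof (rule P.finite_measure_mono)
    \<comment> \<open>The total vote is at least the \<open>g\<close>-sum minus the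
      \<open>h\<close>-sum, hence nonnegative. A tie counts as an error as well, since
      \<open>sgn 0 = 0\<close> differs from the target value -1.\<close>
    show "?good \<subseteq> ?err"
    proof safe
      fix s assume s: "s \<in> space P" "(\<Sum>i<m. h (s i)) \<le> (\<Sum>i<m. g (s i))"
        and err: "sgn (\<Sum>i<m. noisy_label (core_target d) s i
          * euclid_dist d x (fst (s i)) powr (-\<beta>)) = core_target d x"
      have "g (s i) - h (s i) \<le> noisy_label (core_target d) s i * euclid_dist d x (fst (s i)) powr (-\<beta>)" for i
        using core_disjoint_shell[of "fst (s i)" d]
        by (auto simp: g_def h_def noisy_label_def core_target_def w_def)
      then have "(\<Sum>i<m. g (s i) - h (s i))
          \<le> (\<Sum>i<m. noisy_label (core_target d) s i * euclid_dist d x (fst (s i)) powr (-\<beta>))"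
        by (intro sum_mono)
      then have "0 \<le> (\<Sum>i<m. noisy_label (core_target d) s i * euclid_dist d x (fst (s i)) powr (-\<beta>))"
        using s by (simp add: sum_subtractf)
      with err x show False by (simp add: core_target_def sgn_if split: if_splits)
    qed
    have [measurable]: "core_target d \<in> borel_measurable (lborel_d d)"
      using is_target_core[of d] by (simp add: is_target_def)
    have [measurable]: "(\<lambda>s. s i) \<in> measurable P N" if "i < m" for i
      unfolding P_eq using that by simp
    show "?err \<in> sets P"
      unfolding noisy_label_def using xs by measurable
  qed
  finally show ?thesis .
qed

theorem theorem4:
  shows "\<exists>C1 C2::real. 0 < C1 \<and> C1 < 1 \<and> 0 < C2 \<and> C2 < 1 \<and>
    (\<forall>(d::nat) (\<beta>::real). 0 < \<beta> \<and> \<beta> < real d \<longrightarrow>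
       (\<exists>\<mu> f. is_prob_density d \<mu> \<and> is_target d f \<and> regularity d \<mu> f \<and>
          (\<forall>p::real. 0 < p \<and> p < 49/100 \<longrightarrow>
             ereal (C2 * (C1 powr \<beta> * (1 - \<beta> / real d)))
               \<le> liminf (\<lambda>m. ereal (clean_error d \<mu> f \<beta> p m)))))"
proof (rule exI[of _ "1/8"], rule exI[of _ "1/2000"], intro conjI allI impI; (elim conjE)?)
  fix d :: nat and \<beta> :: real
  assume \<beta>: "0 < \<beta>" "\<beta> < real d"
  \<comment> \<open>With C1 = 1/8 and C2 = 1/2000, both independent of \<open>d\<close> and \<beta>,
    the claimed bound is exactly \<alpha>/2: core mass times error probability 1/2.\<close>
  define \<alpha> where "\<alpha> = (1/8) powr \<beta> * (1 - \<beta> / real d) / 1000"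
  have d: "0 < d" using \<beta> by (cases d) auto
  have \<gamma>: "0 < 1 - \<beta> / real d" "1 - \<beta> / real d \<le> 1" using \<beta> d by (auto simp: field_simps)
  have "(1/8) powr \<beta> \<le> (1::real)" using \<beta> by (intro powr_le1) auto
  then have \<alpha>: "0 < \<alpha>" "\<alpha> < 1"
    using \<gamma> mult_mono[of "(1/8) powr \<beta>" 1 "1 - \<beta> / real d" 1] by (auto simp: \<alpha>_def)
  \<comment> \<open>Both are fixed before \<open>p\<close>, so one distribution and one target serve
    all noise levels.\<close>
  let ?\<mu> = "core_shell_density d \<alpha>" and ?f = "core_target d"
  note dens = is_prob_density_core_shell[OF d \<alpha>] and target = is_target_core[of d]
  have "ereal (1/2000 * ((1/8) powr \<beta> * (1 - \<beta> / real d))) \<le> liminf (\<lambda>m. ereal (clean_error d ?\<mu> ?f \<beta> p m))"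
    if p: "0 < p" "p < 49/100" for p
  proof (rule Liminf_bounded)
    have "0 < (9/1000 * (1/4) powr \<beta>)\<^sup>2 / 2" by simp
    then have "(\<lambda>m. exp (- (real m * (9/1000 * (1/4) powr \<beta>)\<^sup>2 / 2))) \<longlonglongrightarrow> 0"
      by real_asymp
    \<comment> \<open>The value 2/10 is what reduces the guaranteed 7/10 to the required
      1/2.\<close>
    then have "eventually (\<lambda>m. exp (- (real m * (9/1000 * (1/4) powr \<beta>)\<^sup>2 / 2)) < 2/10) sequentially"
      by (rule order_tendstoD) simp
    with eventually_gt_at_top[of 0]
    show "eventually (\<lambda>m. ereal (1/2000 * ((1/8) powr \<beta> * (1 - \<beta> / real d)))
        \<le> ereal (clean_error d ?\<mu> ?f \<beta> p m)) sequentially"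
    proof eventually_elim
      case (elim m)
      have "1/2 * measure (D_x d ?\<mu>) (core d) \<le> clean_error d ?\<mu> ?f \<beta> p m"
      proof (rule clean_error_ge[OF dens target d sets_core])
        fix x assume x: "x \<in> core d"
        show "1/2 \<le> measure (sample_measure d ?\<mu> p m) {s \<in> space (sample_measure d ?\<mu> p m).
            sgn (\<Sum>i<m. noisy_label ?f s i * euclid_dist d x (fst (s i)) powr (-\<beta>)) \<noteq> ?f x}"
          using core_error_prob[OF \<beta> p elim(1) x] elim(2) unfolding \<alpha>_def[symmetric] by linarith
      qed simp
      then show ?case
        using measure_D_x_core[OF d \<alpha>] by (simp add: \<alpha>_def)
    qed
  qed
  then show "\<exists>\<mu> f. is_prob_density d \<mu> \<and> is_target d f \<and> regularity d \<mu> f \<and>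
      (\<forall>p::real. 0 < p \<and> p < 49/100 \<longrightarrow>
         ereal (1/2000 * ((1/8) powr \<beta> * (1 - \<beta> / real d)))
           \<le> liminf (\<lambda>m. ereal (clean_error d \<mu> f \<beta> p m)))"
    using dens target regularity_core_shell[OF d \<alpha>] by blast
qed auto

end
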